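(* Let $q\in(1,\infty)$ with $q\neq 2$. (i) For every $d\ge 1$, if $G=(V,E)$ is a finite simple graph with $|V|\leq 2d$, then $G$ is independent in $\ell_q^d$. (ii) The complete graph $K_{2d}$ is minimally rigid in $\ell_q^d$ for all $d\geq 1$.
   Context: $\ell_q^d$ denotes $\mathbb{R}^d$ with the norm $\|x\|_q=(\sum_{k=1}^d|x_k|^q)^{1/q}$. A placement of $G=(V,E)$ in $\ell_q^d$ is a point $p=(p_v)_{v\in V}\in(\mathbb{R}^d)^V$ with $p_v\ne p_w$ for every edge $vw\in E$. The (altered) rigidity matrix $\tilde R(G,p)$ has rows indexed by $E$ and columns indexed by $V\times\{1,\dots,d\}$; for an edge $e=vw$ and $1\le k\le d$, the $(e,(v,k))$ entry is $\operatorname{sgn}((p_v-p_w)_k)\,|(p_v-p_w)_k|^{q-1}$, the $(e,(w,k))$ entry is its negative, and all other entries in row $e$ are $0$. (The rigidity matrix $R(G,p)$ is obtained by dividing each row $vw$ by the positive scalar $\|p_v-p_w\|_q^{q-2}$, so it has the same rank.) The framework $(G,p)$ is independent if the rows of this matrix are linearly independent. It is regular if the rank of the matrix is maximal over all placements of $G$ in $\ell_q^d$. For $q\ne2$, a regular framework $(G,p)$ in $\ell_q^d$ is rigid if and only if $\operatorname{rank}\tilde R(G,p)=d|V|-d$ (this may be taken as the definition). $(G,p)$ is minimally rigid if it is both rigid and independent. The graph $G$ is independent (resp. minimally rigid) in $\ell_q^d$ if $(G,p)$ is independent (resp. minimally rigid) for some placement $p$ in $\ell_q^d$. *)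

theory Defs
  imports Complex_Main "HOL-Library.FuncSet" "HOL-Library.Function_Algebras"
begin

text \<open>
  Finite simple graphs are given by a finite vertex set \<open>V\<close> and a set \<open>E\<close> of two-element
  subsets of \<open>V\<close>. Coordinates of \<open>\<real>\<^sup>d\<close> are indexed by \<open>{..<d}\<close> instead of \<open>{1..d}\<close>, so that the
  dimension is an ordinary natural number.
\<close>

definition complete_edges :: "'v set \<Rightarrow> 'v set set" where
  "complete_edges V = {e. e \<subseteq> V \<and> card e = 2}"

definition simple_graph :: "'v set \<Rightarrow> 'v set set \<Rightarrow> bool" where
  "simple_graph V E \<longleftrightarrow> finite V \<and> E \<subseteq> complete_edges V"

definition placements :: "nat \<Rightarrow> 'v set \<Rightarrow> 'v set set \<Rightarrow> ('v \<Rightarrow> nat \<Rightarrow> real) set" where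
  "placements d V E =
     {p \<in> V \<rightarrow>\<^sub>E ({..<d} \<rightarrow>\<^sub>E UNIV). \<forall>v w. {v, w} \<in> E \<longrightarrow> p v \<noteq> p w}"

text \<open>
  The altered rigidity matrix. For an edge \<open>e = {v, w}\<close> the entries in columns \<open>(v, k)\<close> and
  \<open>(w, k)\<close> are negatives of each other because \<open>sgn\<close> is odd, so no orientation of \<open>e\<close> has to be
  chosen: in column \<open>(v, k)\<close> with \<open>v \<in> e\<close>, the other endpoint of \<open>e\<close> plays the role of \<open>w\<close>.
  Rows are functions on all of \<open>'v \<times> nat\<close>; for \<open>e \<subseteq> V\<close> they vanish outside
  \<open>V \<times> {..<d}\<close>, so linear (in)dependence and rank are unaffected.
\<close>

definition rigidity_matrix ::
    "real \<Rightarrow> nat \<Rightarrow> ('v \<Rightarrow> nat \<Rightarrow> real) \<Rightarrow> 'v set \<Rightarrow> 'v \<times> nat \<Rightarrow> real" where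
  "rigidity_matrix q d p e = (\<lambda>(v, k).
     if v \<in> e \<and> k < d
     then let w = (THE w. e = {v, w})
          in sgn (p v k - p w k) * \<bar>p v k - p w k\<bar> powr (q - 1)
     else 0)"

global_interpretation fun_space: vector_space "\<lambda>(c::real) (f::'c \<Rightarrow> real) x. c * f x"
  by unfold_locales (auto simp: fun_eq_iff algebra_simps)

definition rigidity_rank ::
    "real \<Rightarrow> nat \<Rightarrow> 'v set set \<Rightarrow> ('v \<Rightarrow> nat \<Rightarrow> real) \<Rightarrow> nat" where
  "rigidity_rank q d E p = fun_space.dim (rigidity_matrix q d p ` E)"

text \<open>
  The rows form a family indexed by \<open>E\<close>, whereas the library notion of linear independence is
  one for sets; hence the additional injectivity.
\<close>

definition framework_independent ::
    "real \<Rightarrow> nat \<Rightarrow> 'v set set \<Rightarrow> ('v \<Rightarrow> nat \<Rightarrow> real) \<Rightarrow> bool" where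
  "framework_independent q d E p \<longleftrightarrow>
     inj_on (rigidity_matrix q d p) E \<and>
     fun_space.independent (rigidity_matrix q d p ` E)"

definition framework_regular ::
    "real \<Rightarrow> nat \<Rightarrow> 'v set \<Rightarrow> 'v set set \<Rightarrow> ('v \<Rightarrow> nat \<Rightarrow> real) \<Rightarrow> bool" where
  "framework_regular q d V E p \<longleftrightarrow>
     p \<in> placements d V E \<and>
     (\<forall>p' \<in> placements d V E. rigidity_rank q d E p' \<le> rigidity_rank q d E p)"

text \<open>
  This rank condition characterises rigidity for regular frameworks and \<open>q \<noteq> 2\<close>; regularity is
  therefore part of the definition. It costs nothing in the definition of minimal rigidity below,
  since an independent framework has rank \<open>card E\<close>, the maximum possible.
\<close>

definition framework_rigid ::
    "real \<Rightarrow> nat \<Rightarrow> 'v set \<Rightarrow> 'v set set \<Rightarrow> ('v \<Rightarrow> nat \<Rightarrow> real) \<Rightarrow> bool" where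
  "framework_rigid q d V E p \<longleftrightarrow>
     framework_regular q d V E p \<and>
     int (rigidity_rank q d E p) = int d * int (card V) - int d"

definition framework_minimally_rigid ::
    "real \<Rightarrow> nat \<Rightarrow> 'v set \<Rightarrow> 'v set set \<Rightarrow> ('v \<Rightarrow> nat \<Rightarrow> real) \<Rightarrow> bool" where
  "framework_minimally_rigid q d V E p \<longleftrightarrow>
     framework_rigid q d V E p \<and> framework_independent q d E p"

definition graph_independent :: "real \<Rightarrow> nat \<Rightarrow> 'v set \<Rightarrow> 'v set set \<Rightarrow> bool" where
  "graph_independent q d V E \<longleftrightarrow>
     (\<exists>p \<in> placements d V E. framework_independent q d E p)"

definition graph_minimally_rigid :: "real \<Rightarrow> nat \<Rightarrow> 'v set \<Rightarrow> 'v set set \<Rightarrow> bool" where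
  "graph_minimally_rigid q d V E \<longleftrightarrow>
     (\<exists>p \<in> placements d V E. framework_minimally_rigid q d V E p)"

end

theory Submission
  imports Defs
begin

text \<open>
  A dependence between the rows of the rigidity matrix is an equilibrium stress
  \<open>u\<close>: writing \<open>\<phi> x = sgn x \<bar>x\<bar>\<^sup>q\<^sup>-\<^sup>1\<close>, one has
  \<open>\<Sum>w. u {v, w} \<phi> (p v k - p w k) = 0\<close> for all \<open>v\<close> and \<open>k\<close>. Stress-free placements of
  at most \<open>2d\<close> points in dimension \<open>d\<close> are built by induction on \<open>d\<close>. Given one for \<open>W\<close>,
  add a coordinate that is \<open>0\<close> on \<open>W\<close> and two vertices \<open>a = (A, \<dots>, A, 1)\<close> and
  \<open>b = (A + 1, \<dots>, A + 1, - 1)\<close> with \<open>A\<close> large. Equilibrium in the new coordinate forces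
  \<open>u {b, w} = u {a, w}\<close> and \<open>u {a, b} = - \<kappa> (\<Sum>w. u {a, w})\<close> with \<open>\<kappa> = 1 / \<phi> 2\<close>; equilibrium
  at \<open>a\<close> and \<open>b\<close> in the old coordinates then says that the numbers \<open>u {a, w}\<close> are a linear
  dependence between the vectors \<open>H (p w) \<in> \<real>\<^sup>2\<^sup>d\<close> with entries \<open>\<phi> (A - p w k) + \<kappa>\<close> and
  \<open>\<phi> (A + 1 - p w k) - \<kappa>\<close>. For \<open>q \<noteq> 2\<close> no nonzero linear functional vanishes on \<open>H\<close> of an
  open box, and being stress-free is an open condition, so the points of \<open>W\<close> can be perturbed
  one after the other until the \<open>H (p w)\<close> are linearly independent. Then \<open>u\<close> vanishes on all
  edges at \<open>a\<close> and \<open>b\<close>, and hence everywhere.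
\<close>

section \<open>Linearly independent families\<close>

text \<open>For finite \<open>E\<close>, the matrix \<open>A\<close> with rows \<open>E\<close> and
  columns \<open>C\<close> has trivial left kernel. Indexing by \<open>E\<close> instead of by a set
  of rows makes repeated rows dependent.\<close>

definition family_independent :: "'e set \<Rightarrow> 'c set \<Rightarrow> ('e \<Rightarrow> 'c \<Rightarrow> real) \<Rightarrow> bool" where
  "family_independent E C A \<longleftrightarrow>
     (\<forall>u. (\<forall>c\<in>C. (\<Sum>e\<in>E. u e * A e c) = 0) \<longrightarrow> (\<forall>e\<in>E. u e = 0))"

lemma family_independentI:
  assumes "\<And>u e. (\<And>c. c \<in> C \<Longrightarrow> (\<Sum>e\<in>E. u e * A e c) = 0) \<Longrightarrow> e \<in> E \<Longrightarrow> u e = 0"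
  shows "family_independent E C A"
  using assms unfolding family_independent_def by blast

lemma family_independentD:
  assumes "family_independent E C A" "\<And>c. c \<in> C \<Longrightarrow> (\<Sum>e\<in>E. u e * A e c) = 0" "e \<in> E"
  shows "u e = 0"
  using assms unfolding family_independent_def by blast

lemma family_independent_cong:
  assumes "\<And>e c. e \<in> E \<Longrightarrow> c \<in> C \<Longrightarrow> A e c = B e c"
  shows "family_independent E C A \<longleftrightarrow> family_independent E C B"
  unfolding family_independent_def using assms by (simp cong: sum.cong)

lemma family_independent_mono:
  assumes "family_independent F C A" "E \<subseteq> F" "finite F"
  shows "family_independent E C A"
proof (rule family_independentI)
  fix u e assume u: "\<And>c. c \<in> C \<Longrightarrow> (\<Sum>e\<in>E. u e * A e c) = 0" and e: "e \<in> E"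
  let ?u = "\<lambda>e. if e \<in> E then u e else 0"
  have "(\<Sum>e\<in>F. ?u e * A e c) = 0" if "c \<in> C" for c
  proof -
    have "(\<Sum>e\<in>F. ?u e * A e c) = (\<Sum>e\<in>E. ?u e * A e c)"
      using assms by (intro sum.mono_neutral_right) auto
    then show ?thesis using u[OF that] by (simp cong: sum.cong)
  qed
  from family_independentD[OF assms(1) this, of e] e assms(2) show "u e = 0" by auto
qed

text \<open>One step of Gaussian elimination: multiples of row \<open>x\<close> clear column
  \<open>c0\<close>, and that column determines the coefficient of \<open>x\<close> in any
  dependence.\<close>

lemma family_independent_pivot:
  assumes "finite E" "x \<notin> E" "c0 \<in> C" "A x c0 \<noteq> 0"
  shows "family_independent (insert x E) C A \<longleftrightarrow>
         family_independent E C (\<lambda>e c. A e c - A e c0 / A x c0 * A x c)"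
    (is "_ \<longleftrightarrow> family_independent E C ?B")
proof
  have split: "(\<Sum>e\<in>E. u e * ?B e c) =
      (\<Sum>e\<in>E. u e * A e c) - (\<Sum>e\<in>E. u e * A e c0) / A x c0 * A x c" for u c
    by (simp add: right_diff_distrib sum_subtractf sum_distrib_right sum_divide_distrib mult.assoc)
  {
    assume L: "family_independent (insert x E) C A"
    show "family_independent E C ?B"
    proof (rule family_independentI)
      fix u e assume u: "\<And>c. c \<in> C \<Longrightarrow> (\<Sum>e\<in>E. u e * ?B e c) = 0" and e: "e \<in> E"
      define w where "w = u(x := - (\<Sum>e\<in>E. u e * A e c0) / A x c0)"
      have "(\<Sum>e\<in>E. w e * A e c) = (\<Sum>e\<in>E. u e * A e c)" for c
        using assms by (intro sum.cong) (auto simp: w_def)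
      then have "(\<Sum>e\<in>insert x E. w e * A e c) = 0" if "c \<in> C" for c
        using u[OF that] assms unfolding split by (simp add: w_def)
      from family_independentD[OF L this, of e] e have "w e = 0" by simp
      then show "u e = 0" using e assms by (auto simp: w_def split: if_splits)
    qed
  next
    assume R: "family_independent E C ?B"
    show "family_independent (insert x E) C A"
    proof (rule family_independentI)
      fix u e assume u: "\<And>c. c \<in> C \<Longrightarrow> (\<Sum>e\<in>insert x E. u e * A e c) = 0" and e: "e \<in> insert x E"
      have eq: "u x * A x c + (\<Sum>e\<in>E. u e * A e c) = 0" if "c \<in> C" for c
        using u[OF that] assms by simp
      have ux: "u x = - (\<Sum>e\<in>E. u e * A e c0) / A x c0"
        using eq[OF assms(3)] assms(4) by (simp add: field_simps)
      have "(\<Sum>e\<in>E. u e * ?B e c) = 0" if "c \<in> C" for c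
        using eq[OF that] unfolding split ux by simp
      then have z: "u e = 0" if "e \<in> E" for e
        using family_independentD[OF R] that by blast
      then show "u e = 0" using e ux by auto
    qed
  }
qed

text \<open>Elimination takes the place of minors: a nonzero pivot of the limit is eventually a
  nonzero pivot of \<open>A n\<close>, and the reduced entries converge again.\<close>

lemma eventually_family_independent:
  assumes "finite E"
    and "\<And>e c. e \<in> E \<Longrightarrow> c \<in> C \<Longrightarrow> ((\<lambda>n. A n e c) \<longlongrightarrow> L e c) F"
    and "family_independent E C L"
  shows "eventually (\<lambda>n. family_independent E C (A n)) F"
  using assms
proof (induction E arbitrary: A L rule: finite_induct)
  case empty
  then show ?case by (simp add: family_independent_def)
next
  case (insert x E)
  have "\<exists>c0\<in>C. L x c0 \<noteq> 0"
  proof (rule ccontr)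
    assume neg: "\<not> ?thesis"
    then have "(\<Sum>e\<in>insert x E. (if e = x then 1 else 0) * L e c) = 0" if "c \<in> C" for c
      using that neg insert.hyps by (intro sum.neutral) auto
    from family_independentD[OF insert.prems(2) this, of x] show False by simp
  qed
  then obtain c0 where c0: "c0 \<in> C" "L x c0 \<noteq> 0" by blast
  let ?B = "\<lambda>A e c. A e c - A e c0 / A x c0 * A x c"
  have "eventually (\<lambda>n. family_independent E C (?B (A n))) F"
  proof (rule insert.IH)
    show "((\<lambda>n. ?B (A n) e c) \<longlongrightarrow> ?B L e c) F" if "e \<in> E" "c \<in> C" for e c
      using that c0 by (intro tendsto_intros insert.prems) auto
    show "family_independent E C (?B L)"
      using insert.prems(2) family_independent_pivot[of E x c0 C L] insert.hyps c0 by simp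
  qed
  moreover have "eventually (\<lambda>n. A n x c0 \<noteq> 0) F"
    using insert.prems(1)[of x c0] c0 tendsto_imp_eventually_ne by auto
  ultimately show ?case
    by eventually_elim (use family_independent_pivot[of E x c0 C] insert.hyps c0(1) in blast)
qed

text \<open>Fewer equations than unknowns: equation \<open>x\<close> either is trivial or eliminates
  one unknown \<open>c0\<close> from the others.\<close>

lemma nontrivial_solution:
  fixes h :: "'w \<Rightarrow> 'c \<Rightarrow> real"
  assumes "finite W" "finite C" "card W < card C"
  shows "\<exists>\<alpha>. (\<exists>c\<in>C. \<alpha> c \<noteq> 0) \<and> (\<forall>w\<in>W. (\<Sum>c\<in>C. \<alpha> c * h w c) = 0)"
  using assms
proof (induction W arbitrary: C h rule: finite_induct)
  case empty
  then have "C \<noteq> {}" by auto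
  then show ?case by (intro exI[of _ "\<lambda>_. 1"]) auto
next
  case (insert x W)
  show ?case
  proof (cases "\<exists>c0\<in>C. h x c0 \<noteq> 0")
    case False
    have "card W < card C" using insert by simp
    from insert.IH[OF insert.prems(1) this, of h] obtain \<alpha> where
      "\<exists>c\<in>C. \<alpha> c \<noteq> 0" "\<forall>w\<in>W. (\<Sum>c\<in>C. \<alpha> c * h w c) = 0" by blast
    with False show ?thesis by (intro exI[of _ \<alpha>]) auto
  next
    case True
    then obtain c0 where c0: "c0 \<in> C" "h x c0 \<noteq> 0" by blast
    let ?D = "C - {c0}"
    let ?g = "\<lambda>w c. h w c - h w c0 / h x c0 * h x c"
    have "card W < card ?D" using insert c0 by simp
    from insert.IH[OF _ this, of ?g] insert.prems obtain \<alpha> where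
      \<alpha>: "\<exists>c\<in>?D. \<alpha> c \<noteq> 0" "\<And>w. w \<in> W \<Longrightarrow> (\<Sum>c\<in>?D. \<alpha> c * ?g w c) = 0" by auto
    \<comment> \<open>The value at \<open>c0\<close> is the one that solves equation
      \<open>x\<close>.\<close>
    define \<beta> where "\<beta> = \<alpha>(c0 := - (\<Sum>c\<in>?D. \<alpha> c * h x c) / h x c0)"
    have \<beta>: "(\<Sum>c\<in>C. \<beta> c * h w c) =
        - (\<Sum>c\<in>?D. \<alpha> c * h x c) / h x c0 * h w c0 + (\<Sum>c\<in>?D. \<alpha> c * h w c)" for w
    proof -
      have "(\<Sum>c\<in>?D. \<beta> c * h w c) = (\<Sum>c\<in>?D. \<alpha> c * h w c)"
        by (intro sum.cong) (auto simp: \<beta>_def)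
      then show ?thesis using c0 insert.prems by (simp add: sum.remove[of C c0] \<beta>_def)
    qed
    have "(\<Sum>c\<in>C. \<beta> c * h w c) = (\<Sum>c\<in>?D. \<alpha> c * ?g w c)" for w
      unfolding \<beta>
      by (simp add: right_diff_distrib sum_subtractf sum_distrib_left sum_divide_distrib mult_ac)
    with \<alpha> have "\<forall>w\<in>W. (\<Sum>c\<in>C. \<beta> c * h w c) = 0" by simp
    moreover have "(\<Sum>c\<in>C. \<beta> c * h x c) = 0" using c0 unfolding \<beta> by simp
    moreover have "\<exists>c\<in>C. \<beta> c \<noteq> 0" using \<alpha>(1) by (auto simp: \<beta>_def)
    ultimately show ?thesis by auto
  qed
qed

text \<open>Greedy choice: by counting dimensions, some nonzero functional \<alpha> kills the
  vectors chosen so far, and a next vector not killed by \<alpha> lies outside their span.\<close>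

lemma choose_independent_family:
  fixes S :: "'w \<Rightarrow> ('c \<Rightarrow> real) set"
  assumes "finite W" "finite C" "card W \<le> card C"
    and "\<And>w \<alpha> c. w \<in> W \<Longrightarrow> c \<in> C \<Longrightarrow> \<alpha> c \<noteq> 0 \<Longrightarrow> \<exists>h\<in>S w. (\<Sum>c\<in>C. \<alpha> c * h c) \<noteq> 0"
  shows "\<exists>h. (\<forall>w\<in>W. h w \<in> S w) \<and> family_independent W C h"
  using assms
proof (induction W rule: finite_induct)
  case empty
  then show ?case by (simp add: family_independent_def)
next
  case (insert x W)
  have "card W \<le> card C" using insert.hyps insert.prems(2) by simp
  moreover have "\<exists>h\<in>S w. (\<Sum>c\<in>C. \<alpha> c * h c) \<noteq> 0" if "w \<in> W" "c \<in> C" "\<alpha> c \<noteq> 0" for w \<alpha> c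
    using insert.prems(3)[of w c \<alpha>] that by simp
  ultimately obtain h where h: "\<forall>w\<in>W. h w \<in> S w" "family_independent W C h"
    using insert.IH[OF insert.prems(1)] by blast
  obtain \<alpha> c where \<alpha>: "c \<in> C" "\<alpha> c \<noteq> 0" "\<And>w. w \<in> W \<Longrightarrow> (\<Sum>c\<in>C. \<alpha> c * h w c) = 0"
    using nontrivial_solution[of W C h] insert by auto
  obtain g where g: "g \<in> S x" "(\<Sum>c\<in>C. \<alpha> c * g c) \<noteq> 0"
    using insert.prems(3)[of x c \<alpha>] \<alpha> by auto
  have "family_independent (insert x W) C (h(x := g))"
  proof (rule family_independentI)
    fix u e assume "\<And>c. c \<in> C \<Longrightarrow> (\<Sum>e\<in>insert x W. u e * (h(x := g)) e c) = 0"
      and e: "e \<in> insert x W"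
    moreover have "(\<Sum>e\<in>W. u e * (h(x := g)) e c) = (\<Sum>e\<in>W. u e * h e c)" for c
      using insert.hyps by (intro sum.cong) auto
    ultimately have u: "u x * g c + (\<Sum>e\<in>W. u e * h e c) = 0" if "c \<in> C" for c
      using insert.hyps that by simp
    \<comment> \<open>Applying \<alpha> to the supposed dependence leaves only the term of the new
      vector \<open>g\<close>.\<close>
    have "0 = (\<Sum>c\<in>C. \<alpha> c * (u x * g c + (\<Sum>e\<in>W. u e * h e c)))"
      by (simp add: u)
    also have "\<dots> = u x * (\<Sum>c\<in>C. \<alpha> c * g c) + (\<Sum>c\<in>C. \<Sum>e\<in>W. u e * (\<alpha> c * h e c))"
      by (simp add: algebra_simps sum.distrib sum_distrib_left)
    also have "(\<Sum>c\<in>C. \<Sum>e\<in>W. u e * (\<alpha> c * h e c)) = (\<Sum>e\<in>W. u e * (\<Sum>c\<in>C. \<alpha> c * h e c))"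
      by (subst sum.swap) (simp add: sum_distrib_left)
    also have "\<dots> = 0" by (simp add: \<alpha>)
    finally have ux: "u x = 0" using g by simp
    with u have "u w = 0" if "w \<in> W" for w
      using family_independentD[OF h(2)] that by simp
    with ux e show "u e = 0" by auto
  qed
  moreover have "\<forall>w\<in>insert x W. (h(x := g)) w \<in> S w" using g h by auto
  ultimately show ?case by blast
qed

section \<open>The signed power function\<close>

definition spow :: "real \<Rightarrow> real \<Rightarrow> real" where
  "spow r x = sgn x * \<bar>x\<bar> powr r"

lemma spow_0 [simp]: "spow r 0 = 0" and spow_1 [simp]: "spow r 1 = 1"
  and spow_uminus [simp]: "spow r (- x) = - spow r x"
  by (auto simp: spow_def sgn_minus)

lemma spow_pos: "0 < x \<Longrightarrow> spow r x = x powr r"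
  by (simp add: spow_def)

text \<open>Since \<open>sgn\<close> jumps at 0, the limit 0 is treated separately, by comparison
  with the unsigned power, which tends to 0 for positive \<open>r\<close>.\<close>

lemma tendsto_spow:
  assumes "0 < r" "(f \<longlongrightarrow> l) F"
  shows "((\<lambda>n. spow r (f n)) \<longlongrightarrow> spow r l) F"
proof (cases "l = 0")
  case True
  have "((\<lambda>n. \<bar>f n\<bar> powr r) \<longlongrightarrow> \<bar>l\<bar> powr r) F"
    using assms by (intro tendsto_powr' tendsto_intros) auto
  then have "((\<lambda>n. \<bar>f n\<bar> powr r) \<longlongrightarrow> 0) F" using True by simp
  moreover have "norm (spow r (f n)) \<le> norm (\<bar>f n\<bar> powr r) * 1" for n
    by (auto simp: spow_def sgn_real_def)
  then have "\<forall>\<^sub>F n in F. norm (spow r (f n)) \<le> norm (\<bar>f n\<bar> powr r) * 1"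
    by (rule always_eventually[OF allI])
  ultimately have "((\<lambda>n. spow r (f n)) \<longlongrightarrow> 0) F"
    by (rule tendsto_0_le)
  then show ?thesis using True by simp
next
  case False
  then show ?thesis
    unfolding spow_def using assms by (intro tendsto_intros) auto
qed

text \<open>The only place where \<open>q \<noteq> 2\<close> enters, with \<open>r = q - 1\<close>.\<close>

lemma spow_combination_not_constant:
  fixes r A x \<epsilon> a b K :: real
  assumes "0 < r" "r \<noteq> 1" "0 < \<epsilon>" "x + \<epsilon> \<le> A"
    and const: "\<And>t. \<bar>t - x\<bar> < \<epsilon> \<Longrightarrow> a * spow r (A - t) + b * spow r (A + 1 - t) = K"
  shows "a = 0 \<and> b = 0"
proof -
  have deriv: "a * (A - t) powr (r - 1) + b * (A + 1 - t) powr (r - 1) = 0"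
    if t: "\<bar>t - x\<bar> < \<epsilon>" for t
  proof -
    let ?f = "\<lambda>t. a * (A - t) powr r + b * (A + 1 - t) powr r"
    have pos: "0 < A - s" if "\<bar>s - x\<bar> < \<epsilon>" for s
      using that assms(4) by linarith
    \<comment> \<open>Differentiation removes the constant \<open>K\<close> and lowers both
      exponents to \<open>r - 1\<close>.\<close>
    have "DERIV ?f t :> - r * (a * (A - t) powr (r - 1) + b * (A + 1 - t) powr (r - 1))"
      using pos[OF t] by (auto intro!: derivative_eq_intros simp: algebra_simps powr_diff)
    moreover have "?f s = K" if "\<bar>s - x\<bar> < \<epsilon>" for s
      using const[OF that] pos[OF that] by (simp add: spow_pos)
    then have "\<forall>s. \<bar>t - s\<bar> < \<epsilon> - \<bar>t - x\<bar> \<longrightarrow> ?f t = ?f s"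
      using t by (smt (verit))
    ultimately have "- r * (a * (A - t) powr (r - 1) + b * (A + 1 - t) powr (r - 1)) = 0"
      using t by (intro DERIV_local_const) auto
    with \<open>0 < r\<close> show ?thesis by simp
  qed
  \<comment> \<open>Dividing the derivative by the power of \<open>A + 1 - t\<close> leaves one
    power, that of \<open>R t\<close>, which must be constant unless \<open>a = 0\<close>.\<close>
  define R where "R t = (A - t) / (A + 1 - t)" for t
  have ratio: "a * R t powr (r - 1) = - b" if "\<bar>t - x\<bar> < \<epsilon>" for t
  proof -
    have "0 < A - t" using that assms(4) by linarith
    then show ?thesis
      using deriv[OF that] by (simp add: R_def powr_divide divide_simps)
  qed
  have "a = 0"
  proof (rule ccontr)
    assume "a \<noteq> 0"
    with ratio[of x] ratio[of "x + \<epsilon> / 2"] \<open>0 < \<epsilon>\<close>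
    have eq: "R x powr (r - 1) = R (x + \<epsilon> / 2) powr (r - 1)"
      by (smt (verit) field_sum_of_halves mult_cancel_left)
    have p: "0 < R x" "0 < R (x + \<epsilon> / 2)" using assms by (auto simp: R_def)
    \<comment> \<open>As \<open>r - 1\<close> is nonzero, the power can be undone; but
      \<open>R t = 1 - 1 / (A + 1 - t)\<close> is strictly decreasing here.\<close>
    have "R x = (R x powr (r - 1)) powr (1 / (r - 1))"
      using p assms by (simp add: powr_powr)
    also have "\<dots> = R (x + \<epsilon> / 2)"
      unfolding eq using p assms by (simp add: powr_powr)
    finally show False
      using assms by (simp add: R_def divide_simps) (auto simp: algebra_simps)
  qed
  with ratio[of x] \<open>0 < \<epsilon>\<close> show ?thesis by simp
qed

section \<open>Equilibrium stresses of complete graphs\<close>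

lemma finite_complete_edges: "finite V \<Longrightarrow> finite (complete_edges V)"
  by (auto simp: complete_edges_def intro: finite_subset[of _ "Pow V"])

lemma complete_edges_doubleton [simp]:
  "{v, w} \<in> complete_edges V \<longleftrightarrow> v \<in> V \<and> w \<in> V \<and> v \<noteq> w"
  by (auto simp: complete_edges_def card_insert_if)

lemma complete_edgesE:
  assumes "e \<in> complete_edges V"
  obtains v w where "e = {v, w}" "v \<in> V" "w \<in> V" "v \<noteq> w"
  using assms by (auto simp: complete_edges_def card_2_iff)

lemma rigidity_matrix_edge:
  assumes "v \<noteq> w" "k < d"
  shows "rigidity_matrix q d p {v, w} (v, k) = spow (q - 1) (p v k - p w k)"
proof -
  have "(THE x. {v, w} = {v, x}) = w"
    using assms by (intro the_equality) (auto simp: doubleton_eq_iff)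
  then show ?thesis using assms by (simp add: rigidity_matrix_def spow_def)
qed

lemma rigidity_matrix_nonincident: "v \<notin> e \<Longrightarrow> rigidity_matrix q d p e (v, k) = 0"
  by (simp add: rigidity_matrix_def)

lemma rigidity_matrix_cong:
  assumes "e \<in> complete_edges V" "\<And>v k. v \<in> V \<Longrightarrow> k < d \<Longrightarrow> p v k = p' v k"
  shows "rigidity_matrix q d p e = rigidity_matrix q d p' e"
proof
  fix c :: "'a \<times> nat"
  obtain v k where c: "c = (v, k)" by fastforce
  show "rigidity_matrix q d p e c = rigidity_matrix q d p' e c"
  proof (cases "v \<in> e \<and> k < d")
    case True
    with assms(1) obtain w where w: "e = {v, w}" "v \<in> V" "w \<in> V" "v \<noteq> w"
      by (auto elim!: complete_edgesE)
    with True assms(2) show ?thesis by (simp add: c rigidity_matrix_edge)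
  qed (auto simp: c rigidity_matrix_def)
qed

text \<open>The summand for \<open>w = v\<close> vanishes because \<open>spow\<close> is \<open>0\<close> at \<open>0\<close>.\<close>

lemma sum_rigidity_matrix:
  assumes "finite V" "v \<in> V" "k < d"
  shows "(\<Sum>e\<in>complete_edges V. u e * rigidity_matrix q d p e (v, k)) =
         (\<Sum>w\<in>V. u {v, w} * spow (q - 1) (p v k - p w k))"
proof -
  let ?I = "(\<lambda>w. {v, w}) ` (V - {v})"
  have "(\<Sum>e\<in>complete_edges V. u e * rigidity_matrix q d p e (v, k)) =
        (\<Sum>e\<in>?I. u e * rigidity_matrix q d p e (v, k))"
  proof (rule sum.mono_neutral_right)
    show "finite (complete_edges V)" using assms finite_complete_edges by blast
    show "?I \<subseteq> complete_edges V" using assms by auto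
    have "v \<notin> e" if "e \<in> complete_edges V - ?I" for e
      using that by (auto elim!: complete_edgesE simp: doubleton_eq_iff)
    then show "\<forall>e\<in>complete_edges V - ?I. u e * rigidity_matrix q d p e (v, k) = 0"
      by (simp add: rigidity_matrix_nonincident)
  qed
  also have "\<dots> = (\<Sum>w\<in>V - {v}. u {v, w} * rigidity_matrix q d p {v, w} (v, k))"
    by (subst sum.reindex) (auto simp: inj_on_def doubleton_eq_iff)
  also have "\<dots> = (\<Sum>w\<in>V - {v}. u {v, w} * spow (q - 1) (p v k - p w k))"
    using assms by (intro sum.cong) (auto simp: rigidity_matrix_edge)
  also have "\<dots> = (\<Sum>w\<in>V. u {v, w} * spow (q - 1) (p v k - p w k))"
    using assms by (simp add: sum.remove)
  finally show ?thesis .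
qed

text \<open>Complete graphs suffice: independence passes to subsets of the edges by
  \<open>family_independent_mono\<close>.\<close>

abbreviation stress_free :: "real \<Rightarrow> nat \<Rightarrow> 'v set \<Rightarrow> ('v \<Rightarrow> nat \<Rightarrow> real) \<Rightarrow> bool" where
  "stress_free q d V p \<equiv>
     family_independent (complete_edges V) (V \<times> {..<d}) (rigidity_matrix q d p)"

lemma stress_freeI:
  assumes "finite V"
    and "\<And>u v w. (\<And>v k. v \<in> V \<Longrightarrow> k < d \<Longrightarrow>
          (\<Sum>w\<in>V. u {v, w} * spow (q - 1) (p v k - p w k)) = 0) \<Longrightarrow>
        v \<in> V \<Longrightarrow> w \<in> V \<Longrightarrow> v \<noteq> w \<Longrightarrow> u {v, w} = 0"
  shows "stress_free q d V p"
proof (rule family_independentI)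
  fix u e
  assume u: "\<And>c. c \<in> V \<times> {..<d} \<Longrightarrow>
      (\<Sum>e\<in>complete_edges V. u e * rigidity_matrix q d p e c) = 0"
    and e: "e \<in> complete_edges V"
  from e obtain v w where "e = {v, w}" "v \<in> V" "w \<in> V" "v \<noteq> w" by (rule complete_edgesE)
  moreover have "(\<Sum>w\<in>V. u {v, w} * spow (q - 1) (p v k - p w k)) = 0"
    if "v \<in> V" "k < d" for v k
    using u[of "(v, k)"] that sum_rigidity_matrix[OF assms(1) that] by simp
  ultimately show "u e = 0" using assms(2) by blast
qed

lemma stress_freeD:
  assumes "stress_free q d V p" "finite V"
    and "\<And>v k. v \<in> V \<Longrightarrow> k < d \<Longrightarrow>
          (\<Sum>w\<in>V. u {v, w} * spow (q - 1) (p v k - p w k)) = 0"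
    and "v \<in> V" "w \<in> V" "v \<noteq> w"
  shows "u {v, w} = 0"
proof (rule family_independentD[OF assms(1)])
  show "{v, w} \<in> complete_edges V" using assms by simp
  show "(\<Sum>e\<in>complete_edges V. u e * rigidity_matrix q d p e c) = 0"
    if "c \<in> V \<times> {..<d}" for c
    using that assms(3) sum_rigidity_matrix[OF assms(2)] by (cases c) auto
qed

text \<open>For \<open>q > 1\<close> the matrix entries depend continuously on the placement.
  Otherwise counterexamples within \<open>1 / (n + 1)\<close> would converge to \<open>p\<close>,
  against \<open>eventually_family_independent\<close>.\<close>

lemma stress_free_open:
  assumes "1 < q" "finite V" "stress_free q d V p"
  obtains \<epsilon> where "0 < \<epsilon>"
    "\<And>p'. (\<And>v k. v \<in> V \<Longrightarrow> k < d \<Longrightarrow> \<bar>p' v k - p v k\<bar> < \<epsilon>) \<Longrightarrow> stress_free q d V p'"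
proof -
  have "\<exists>\<epsilon>>0. \<forall>p'. (\<forall>v\<in>V. \<forall>k<d. \<bar>p' v k - p v k\<bar> < \<epsilon>) \<longrightarrow> stress_free q d V p'"
  proof (rule ccontr)
    assume neg: "\<not> ?thesis"
    have "\<exists>p'. (\<forall>v\<in>V. \<forall>k<d. \<bar>p' v k - p v k\<bar> < inverse (real (Suc n))) \<and> \<not> stress_free q d V p'" for n
    proof -
      have "0 < inverse (real (Suc n))" by simp
      with neg show ?thesis by blast
    qed
    then obtain P where P: "\<And>n v k. v \<in> V \<Longrightarrow> k < d \<Longrightarrow> \<bar>P n v k - p v k\<bar> < inverse (real (Suc n))"
      and nP: "\<And>n. \<not> stress_free q d V (P n)" by metis
    have lim: "(\<lambda>n. P n v k) \<longlonglongrightarrow> p v k" if "v \<in> V" "k < d" for v k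
    proof (rule LIM_zero_cancel, rule tendsto_0_le[OF LIMSEQ_inverse_real_of_nat])
      show "\<forall>\<^sub>F n in sequentially. norm (P n v k - p v k) \<le> norm (inverse (real (Suc n))) * 1"
        using P[OF that] by (intro always_eventually) (simp add: less_imp_le)
    qed
    have "(\<lambda>n. rigidity_matrix q d (P n) e c) \<longlonglongrightarrow> rigidity_matrix q d p e c"
      if e: "e \<in> complete_edges V" and "c \<in> V \<times> {..<d}" for e c
    proof -
      from that(2) obtain v k where c: "c = (v, k)" "v \<in> V" "k < d" by auto
      show ?thesis
      proof (cases "v \<in> e")
        case True
        with e obtain w where w: "e = {v, w}" "w \<in> V" "v \<noteq> w"
          by (auto elim!: complete_edgesE)
        show ?thesis
          using w c assms(1) lim by (simp add: rigidity_matrix_edge tendsto_spow tendsto_diff)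
      qed (simp add: c rigidity_matrix_nonincident)
    qed
    then have "eventually (\<lambda>n. stress_free q d V (P n)) sequentially"
      using assms by (intro eventually_family_independent finite_complete_edges) auto
    with nP show False by simp
  qed
  with that show thesis by blast
qed

section \<open>Stress-free placements by induction on the dimension\<close>

lemma stress_free_add_two_vertices:
  fixes p :: "'v \<Rightarrow> nat \<Rightarrow> real"
  assumes q: "1 < q" "q \<noteq> 2"
    and W: "finite W" "card W \<le> 2 * d" "a \<notin> W" "b \<notin> W" "a \<noteq> b"
    and p: "stress_free q d W p"
  shows "\<exists>P. stress_free q (Suc d) (insert a (insert b W)) P"
proof -
  let ?\<phi> = "spow (q - 1)"
  have \<phi>2: "?\<phi> 2 \<noteq> 0" by (simp add: spow_def)
  define \<kappa> where "\<kappa> = 1 / ?\<phi> 2"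
  obtain \<epsilon> where \<epsilon>: "0 < \<epsilon>" and
    near: "\<And>p'. (\<And>v k. v \<in> W \<Longrightarrow> k < d \<Longrightarrow> \<bar>p' v k - p v k\<bar> < \<epsilon>) \<Longrightarrow> stress_free q d W p'"
    using stress_free_open[OF q(1) W(1) p] by blast
  \<comment> \<open>The sum dominates every coordinate, and the extra \<epsilon> keeps
    \<open>A - t\<close> positive throughout the box, where \<open>spow\<close> is an ordinary
    power.\<close>
  define A where "A = (\<Sum>(v, k)\<in>W \<times> {..<d}. \<bar>p v k\<bar>) + \<epsilon>"
  have A: "p v k + \<epsilon> \<le> A" if "v \<in> W" "k < d" for v k
    using member_le_sum[of "(v, k)" "W \<times> {..<d}" "\<lambda>(v, k). \<bar>p v k\<bar>"] that W(1)
    by (auto simp: A_def)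
  \<comment> \<open>The flag \<open>False\<close> marks the equations at \<open>a\<close>,
    \<open>True\<close> those at \<open>b\<close>; thus \<open>C\<close> has exactly
    \<open>2 * d\<close> elements.\<close>
  define C where "C = {..<d} \<times> (UNIV :: bool set)"
  define H where "H x = (\<lambda>(k, i). if i then ?\<phi> (A + 1 - x k) - \<kappa> else ?\<phi> (A - x k) + \<kappa>)"
    for x :: "nat \<Rightarrow> real"
  have "\<exists>h. (\<forall>v\<in>W. h v \<in> H ` {x. \<forall>k<d. \<bar>x k - p v k\<bar> < \<epsilon>}) \<and> family_independent W C h"
  proof (rule choose_independent_family)
    show "finite C" "card W \<le> card C" using W by (auto simp: C_def)
    fix v \<alpha> c assume v: "v \<in> W" and "c \<in> C" "\<alpha> c \<noteq> (0 :: real)"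
    then obtain l i where l: "l < d" "\<alpha> (l, i) \<noteq> 0" by (auto simp: C_def)
    show "\<exists>h\<in>H ` {x. \<forall>k<d. \<bar>x k - p v k\<bar> < \<epsilon>}. (\<Sum>c\<in>C. \<alpha> c * h c) \<noteq> 0"
    proof (rule ccontr)
      assume "\<not> ?thesis"
      then have zero: "(\<Sum>c\<in>C. \<alpha> c * H x c) = 0" if "\<And>k. k < d \<Longrightarrow> \<bar>x k - p v k\<bar> < \<epsilon>" for x
        using that by blast
      have split: "(\<Sum>c\<in>C. \<alpha> c * H x c) =
          (\<Sum>k<d. \<alpha> (k, False) * H x (k, False) + \<alpha> (k, True) * H x (k, True))" for x
        by (simp add: C_def sum.cartesian_product' UNIV_bool)
      \<comment> \<open>Only coordinate \<open>l\<close> will be varied; \<open>K\<close> collects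
        all terms that do not depend on it.\<close>
      define K where "K = - (\<Sum>k\<in>{..<d} - {l}. \<alpha> (k, False) * H (p v) (k, False)
          + \<alpha> (k, True) * H (p v) (k, True)) - \<alpha> (l, False) * \<kappa> + \<alpha> (l, True) * \<kappa>"
      have "\<alpha> (l, False) * ?\<phi> (A - t) + \<alpha> (l, True) * ?\<phi> (A + 1 - t) = K"
        if t: "\<bar>t - p v l\<bar> < \<epsilon>" for t
      proof -
        let ?x = "(p v)(l := t)"
        have "(\<Sum>k\<in>{..<d} - {l}. \<alpha> (k, False) * H ?x (k, False) + \<alpha> (k, True) * H ?x (k, True)) =
            (\<Sum>k\<in>{..<d} - {l}. \<alpha> (k, False) * H (p v) (k, False) + \<alpha> (k, True) * H (p v) (k, True))"
          by (intro sum.cong) (auto simp: H_def)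
        moreover have "(\<Sum>c\<in>C. \<alpha> c * H ?x c) = 0"
          using t \<epsilon> by (intro zero) auto
        ultimately show ?thesis
          unfolding split K_def using l by (simp add: sum.remove[of _ l] H_def algebra_simps)
      qed
      with q \<epsilon> A[OF v l(1)] have "\<alpha> (l, False) = 0 \<and> \<alpha> (l, True) = 0"
        by (intro spow_combination_not_constant[of "q - 1" \<epsilon> "p v l" A]) auto
      with l(2) show False by (cases i) auto
    qed
  qed (use W in auto)
  then obtain h where h: "family_independent W C h"
    and "\<forall>v\<in>W. \<exists>x. h v = H x \<and> (\<forall>k<d. \<bar>x k - p v k\<bar> < \<epsilon>)"
    unfolding image_iff by blast
  then obtain p' where p': "\<And>v. v \<in> W \<Longrightarrow> h v = H (p' v)"
    "\<And>v k. v \<in> W \<Longrightarrow> k < d \<Longrightarrow> \<bar>p' v k - p v k\<bar> < \<epsilon>" by metis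
  have ind: "family_independent W C (\<lambda>v. H (p' v))"
    using h p'(1) family_independent_cong[of W C h "\<lambda>v. H (p' v)"] by simp
  define P where "P v k =
     (if v = a then if k < d then A else 1
      else if v = b then if k < d then A + 1 else - 1
      else if k < d then p' v k else 0)" for v k
  let ?V = "insert a (insert b W)"
  have Pa: "P a k = (if k < d then A else 1)" and Pb: "P b k = (if k < d then A + 1 else - 1)" for k
    using W by (auto simp: P_def)
  have PW: "P w k = (if k < d then p' w k else 0)" if "w \<in> W" for w k
    using W that by (auto simp: P_def)
  have "stress_free q (Suc d) ?V P"
  proof (rule stress_freeI)
    show "finite ?V" using W by simp
    fix u v w
    assume "\<And>v k. v \<in> ?V \<Longrightarrow> k < Suc d \<Longrightarrow> (\<Sum>w\<in>?V. u {v, w} * ?\<phi> (P v k - P w k)) = 0"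
    then have eq: "u {v, a} * ?\<phi> (P v k - P a k) + (u {v, b} * ?\<phi> (P v k - P b k)
        + (\<Sum>w\<in>W. u {v, w} * ?\<phi> (P v k - P w k))) = 0" if "v \<in> ?V" "k < Suc d" for v k
      using that W by simp
    \<comment> \<open>The new coordinate \<open>d\<close> is 0 on \<open>W\<close>, 1 at
      \<open>a\<close> and -1 at \<open>b\<close>, so at \<open>w\<close> only the edges to
      \<open>a\<close> and \<open>b\<close> contribute, with opposite signs.\<close>
    have uab: "u {b, w} = u {a, w}" if "w \<in> W" for w
      using eq[of w d] that by (simp add: Pa Pb PW insert_commute)
    let ?S = "\<Sum>w\<in>W. u {a, w}"
    have "u {a, b} * ?\<phi> 2 + ?S = 0"
      using eq[of a d] by (simp add: Pa Pb PW)
    then have ab: "u {a, b} = - (\<kappa> * ?S)"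
      using \<phi>2 by (simp add: \<kappa>_def field_simps)
    have ua: "u {a, w} = 0" if "w \<in> W" for w
    proof (rule family_independentD[OF ind _ that])
      fix c assume "c \<in> C"
      then obtain k i where c: "c = (k, i)" "k < d" by (auto simp: C_def)
      \<comment> \<open>In every old coordinate \<open>a\<close> and \<open>b\<close> differ by 1,
        so their edge contributes \<open>u {a, b}\<close> up to sign. Eliminating it by
        \<open>ab\<close> produces the \<kappa> terms of \<open>H\<close>.\<close>
      have "(\<Sum>w\<in>W. u {a, w} * ?\<phi> (A - p' w k)) - u {a, b} = 0"
        using eq[of a k] c by (simp add: Pa Pb PW)
      moreover have "(\<Sum>w\<in>W. u {b, w} * ?\<phi> (A + 1 - p' w k)) + u {a, b} = 0"
        using eq[of b k] c by (simp add: Pa Pb PW insert_commute)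
      then have "(\<Sum>w\<in>W. u {a, w} * ?\<phi> (A + 1 - p' w k)) + u {a, b} = 0"
        by (simp add: uab)
      ultimately show "(\<Sum>w\<in>W. u {a, w} * H (p' w) c) = 0"
        unfolding ab c H_def
        by (cases i) (simp_all add: distrib_left right_diff_distrib sum.distrib sum_subtractf
            sum_distrib_left mult.commute)
    qed
    have ub: "u {b, w} = 0" if "w \<in> W" for w using ua uab that by simp
    have "u {a, b} = 0" using ab ua by simp
    \<comment> \<open>With the edges at \<open>a\<close> and \<open>b\<close> gone, equilibrium in
      the old coordinates is that of \<open>p'\<close> on \<open>W\<close>.\<close>
    moreover have "u {v, w} = 0" if "v \<in> W" "w \<in> W" "v \<noteq> w" for v w
    proof (rule stress_freeD[OF _ W(1) _ that])
      show "stress_free q d W p'" using near p'(2) by blast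
      show "(\<Sum>w\<in>W. u {v, w} * ?\<phi> (p' v k - p' w k)) = 0" if "v \<in> W" "k < d" for v k
        using eq[of v k] that ua[of v] ub[of v] by (simp add: PW insert_commute)
    qed
    moreover assume "v \<in> ?V" "w \<in> ?V" "v \<noteq> w"
    moreover have "u {w, a} = 0" "u {w, b} = 0" if "w \<in> W" for w
      using ua[OF that] ub[OF that] by (simp_all only: insert_commute[of w])
    moreover have "u {b, a} = 0" using \<open>u {a, b} = 0\<close> by (simp add: insert_commute)
    ultimately show "u {v, w} = 0" using ua ub by blast
  qed
  then show ?thesis by blast
qed

text \<open>Each dimension pays for two vertices; with fewer than two left there are no
  edges.\<close>

lemma exists_stress_free:
  assumes "1 < q" "q \<noteq> 2" "finite V" "card V \<le> 2 * d"
  shows "\<exists>p. stress_free q d V p"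
  using assms(3,4)
proof (induction d arbitrary: V)
  case 0
  then have "complete_edges V = {}" by (auto elim!: complete_edgesE)
  then show ?case by (simp add: family_independent_def)
next
  case (Suc d)
  show ?case
  proof (cases "card V \<le> 1")
    case True
    then have "complete_edges V = {}"
      using Suc.prems by (auto elim!: complete_edgesE simp: card_le_Suc0_iff_eq)
    then show ?thesis by (simp add: family_independent_def)
  next
    case False
    then obtain a b where ab: "a \<in> V" "b \<in> V" "a \<noteq> b"
      using Suc.prems by (auto simp: card_le_Suc0_iff_eq)
    let ?W = "V - {a, b}"
    have V: "V = insert a (insert b ?W)" using ab by auto
    have W: "finite ?W" "card ?W \<le> 2 * d"
      using Suc.prems ab by (auto simp: card_Diff_subset)
    from Suc.IH[OF this] obtain p where "stress_free q d ?W p" by blast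
    from stress_free_add_two_vertices[OF assms(1,2) W _ _ ab(3) this] V show ?thesis by simp
  qed
qed

section \<open>Independent frameworks\<close>

text \<open>Passes from families to the library notion for sets of rows.\<close>

lemma framework_independentI:
  assumes "finite E" "family_independent E C (rigidity_matrix q d p)"
  shows "framework_independent q d E p"
proof -
  let ?R = "rigidity_matrix q d p"
  have inj: "inj_on ?R E"
  proof (rule inj_onI, rule ccontr)
    fix e f assume ef: "e \<in> E" "f \<in> E" "?R e = ?R f" "e \<noteq> f"
    \<comment> \<open>Two equal rows would carry the dependence with coefficients 1 and -1.\<close>
    let ?u = "\<lambda>g. (if g = e then 1 else 0) - (if g = f then 1 else 0 :: real)"
    have "?u e = 0"
    proof (rule family_independentD[OF assms(2) _ ef(1), of ?u])
      show "(\<Sum>g\<in>E. ?u g * ?R g c) = 0" for c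
        using ef assms(1)
        by (simp add: left_diff_distrib sum_subtractf if_distrib[of "\<lambda>x. x * _"] cong: if_cong)
    qed
    with ef show False by simp
  qed
  have "fun_space.independent (?R ` E)"
  proof (rule fun_space.independent_if_scalars_zero)
    fix f x assume f: "(\<Sum>x\<in>?R ` E. (\<lambda>y. f x * x y)) = 0" and x: "x \<in> ?R ` E"
    then obtain e where e: "e \<in> E" "x = ?R e" by blast
    have "f (?R e) = 0"
    proof (rule family_independentD[OF assms(2) _ e(1), of "\<lambda>e. f (?R e)"])
      fix c
      have "(\<Sum>e\<in>E. (\<lambda>y. f (?R e) * ?R e y)) = 0"
        using f by (simp add: sum.reindex[OF inj])
      then have "(\<Sum>e\<in>E. (\<lambda>y. f (?R e) * ?R e y)) c = 0" by simp
      moreover have "(\<Sum>e\<in>F. (\<lambda>y. f (?R e) * ?R e y)) c = (\<Sum>e\<in>F. f (?R e) * ?R e c)" for F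
        by (induction F rule: infinite_finite_induct) auto
      ultimately show "(\<Sum>e\<in>E. f (?R e) * ?R e c) = 0" by simp
    qed
    with e show "f x = 0" by simp
  qed (use assms in simp)
  with inj show ?thesis by (simp add: framework_independent_def)
qed

lemma exists_independent_placement:
  assumes "1 < q" "q \<noteq> 2" "simple_graph V E" "card V \<le> 2 * d"
  shows "\<exists>p \<in> placements d V E. framework_independent q d E p"
proof -
  have fin: "finite V" and E: "E \<subseteq> complete_edges V"
    using assms(3) by (auto simp: simple_graph_def)
  obtain p where p: "stress_free q d V p"
    using exists_stress_free[OF assms(1,2) fin assms(4)] by blast
  \<comment> \<open>Restriction supplies the extensionality that \<open>placements\<close> demands
    and leaves the rows unchanged.\<close>
  define p' where "p' = (\<lambda>v\<in>V. \<lambda>k\<in>{..<d}. p v k)"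
  have "rigidity_matrix q d p' e = rigidity_matrix q d p e" if "e \<in> complete_edges V" for e
    using that by (rule rigidity_matrix_cong) (auto simp: p'_def)
  with p have p': "stress_free q d V p'"
    by (subst family_independent_cong) auto
  have "p' v \<noteq> p' w" if vw: "{v, w} \<in> E" for v w
  proof
    assume eq: "p' v = p' w"
    have "{v, w} \<in> complete_edges V" using vw E by blast
    then have v: "v \<in> V" "w \<in> V" "v \<noteq> w" by simp_all
    \<comment> \<open>Coinciding endpoints make the row of their edge zero, so its indicator would
      be a nonzero stress.\<close>
    define u where "u e = (if e = {v, w} then 1 else 0 :: real)" for e
    have "u {v, w} = 0"
    proof (rule stress_freeD[OF p' fin _ v])
      show "(\<Sum>y\<in>V. u {x, y} * spow (q - 1) (p' x k - p' y k)) = 0" for x k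
        using eq by (intro sum.neutral) (auto simp: u_def doubleton_eq_iff)
    qed
    then show False by (simp add: u_def)
  qed
  then have "p' \<in> placements d V E" by (auto simp: placements_def p'_def)
  moreover have "framework_independent q d E p'"
    using family_independent_mono[OF p' E] fin E finite_complete_edges[OF fin]
    by (intro framework_independentI) (auto intro: finite_subset)
  ultimately show ?thesis by blast
qed

section \<open>Rank and regularity of independent frameworks\<close>

lemma rigidity_rank_le_card: "finite E \<Longrightarrow> rigidity_rank q d E p \<le> card E"
  unfolding rigidity_rank_def
  by (rule order_trans[OF fun_space.dim_le_card' card_image_le]) auto

text \<open>With \<open>rigidity_rank_le_card\<close>, this makes an independent placement of a
  finite graph regular.\<close>

lemma rigidity_rank_independent:
  "framework_independent q d E p \<Longrightarrow> rigidity_rank q d E p = card E"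
  unfolding rigidity_rank_def framework_independent_def
  by (simp add: fun_space.dim_eq_card_independent card_image)

theorem corollary3p4:
  fixes q :: real
  assumes "1 < q" and "q \<noteq> 2"
  shows "(\<forall>d\<ge>1. \<forall>(V :: 'v set) E.
            simple_graph V E \<and> card V \<le> 2 * d \<longrightarrow> graph_independent q d V E) \<and>
         (\<forall>d\<ge>1. \<forall>V :: 'w set.
            finite V \<and> card V = 2 * d \<longrightarrow> graph_minimally_rigid q d V (complete_edges V))"
proof (intro conjI allI impI)
  fix d :: nat and V :: "'v set" and E
  assume "simple_graph V E \<and> card V \<le> 2 * d"
  then show "graph_independent q d V E"
    unfolding graph_independent_def using exists_independent_placement assms by blast
next
  fix d :: nat and V :: "'w set"
  assume d: "1 \<le> d" and V: "finite V \<and> card V = 2 * d"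
  let ?E = "complete_edges V"
  have fin: "finite ?E" using V finite_complete_edges by blast
  obtain p where p: "p \<in> placements d V ?E" "framework_independent q d ?E p"
    using exists_independent_placement[OF assms, of V ?E d] V by (auto simp: simple_graph_def)
  \<comment> \<open>The edge count \<open>d * (2 * d - 1)\<close> of the complete graph equals the
    rank required for rigidity on \<open>2 * d\<close> vertices.\<close>
  have "card ?E = 2 * d choose 2"
    unfolding complete_edges_def using V n_subsets[of V 2] by simp
  also have "\<dots> = d * (2 * d - 1)" by (simp add: choose_two)
  finally have "int (card ?E) = int d * int (card V) - int d"
    using d V by (simp add: of_nat_diff algebra_simps)
  with p fin have "framework_minimally_rigid q d V ?E p"
    by (auto simp: framework_minimally_rigid_def framework_rigid_def framework_regular_def
        rigidity_rank_independent rigidity_rank_le_card)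
  with p show "graph_minimally_rigid q d V ?E"
    unfolding graph_minimally_rigid_def by blast
qed

end
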